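(* Let $G$ and $H$ be finite groups such that $|G|$ and $|H|$ have the same prime divisors, and let $\alpha\colon G\to\operatorname{Aut}(H)$ be an action by automorphisms. Then every connected component of $\mathcal{C}(\alpha)$ has diameter at most $4$ (i.e. any two vertices in the same connected component are joined by a path of length at most $4$).
   Context: For an action $\alpha$ of a finite group $G$ on a finite group $H$ by automorphisms, $\mathcal{C}(\alpha)$ is the simple undirected graph whose vertices are the non-trivial orbits of the action (orbits of size $>1$), two distinct vertices $L_1,L_2$ being adjacent if and only if $\gcd(|L_1|,|L_2|)\neq 1$. *)

theory Defs
  imports "HOL-Algebra.Group_Action" "HOL-Computational_Algebra.Primes"
begin

definition orbit_graph_vertices :: "('g, 'c) monoid_scheme \<Rightarrow> ('h, 'd) monoid_scheme \<Rightarrow> ('g \<Rightarrow> 'h \<Rightarrow> 'h) \<Rightarrow> 'h set set"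
  where "orbit_graph_vertices G H \<alpha> = {L \<in> orbits G (carrier H) \<alpha>. card L > 1}"

definition orbit_graph_adj :: "('g, 'c) monoid_scheme \<Rightarrow> ('h, 'd) monoid_scheme \<Rightarrow> ('g \<Rightarrow> 'h \<Rightarrow> 'h) \<Rightarrow> 'h set \<Rightarrow> 'h set \<Rightarrow> bool"
  where "orbit_graph_adj G H \<alpha> L1 L2 \<longleftrightarrow>
     L1 \<in> orbit_graph_vertices G H \<alpha> \<and> L2 \<in> orbit_graph_vertices G H \<alpha> \<and>
     L1 \<noteq> L2 \<and> gcd (card L1) (card L2) \<noteq> 1"

text \<open>A walk in the graph given as the (nonempty) list of its vertices; its length is
  (length of the list - 1) edges.\<close>
definition orbit_graph_walk :: "('g, 'c) monoid_scheme \<Rightarrow> ('h, 'd) monoid_scheme \<Rightarrow> ('g \<Rightarrow> 'h \<Rightarrow> 'h) \<Rightarrow> 'h set list \<Rightarrow> bool"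
  where "orbit_graph_walk G H \<alpha> ps \<longleftrightarrow>
     ps \<noteq> [] \<and> set ps \<subseteq> orbit_graph_vertices G H \<alpha> \<and>
     (\<forall>i. Suc i < length ps \<longrightarrow> orbit_graph_adj G H \<alpha> (ps ! i) (ps ! Suc i))"

end

theory Submission
  imports Defs
begin

text \<open>If \<open>orb a\<close> and \<open>orb b\<close> have coprime sizes and no orbit shares a factor with both
  (so that they are at distance at least 3), and \<open>orb a\<close> is the smaller one, then the quotients
  \<open>a' a''\<inverse>\<close> of elements of \<open>orb a\<close> all stabilise \<open>orb b\<close> under left multiplication, and a
  subgroup stabilising \<open>orb b\<close> has order dividing \<open>|orb b|\<close>. On a geodesic of length at least 5
  let \<open>x\<close> be the end with the smaller orbit, \<open>z\<close> the other end and \<open>y\<close> the vertex two steps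
  before \<open>z\<close>. If \<open>|x| < |y|\<close>, the quotients from \<open>x\<close> generate a nontrivial subgroup whose order
  divides the coprime numbers \<open>|y|\<close> and \<open>|z|\<close>. If \<open>|y| < |x|\<close>, the left stabiliser of \<open>x\<close>
  is nontrivial, and, being contained in the set of quotients from \<open>x\<close>, it also stabilises
  \<open>z\<close>; so its order divides the coprime numbers \<open>|x|\<close> and \<open>|z|\<close>.\<close>

section \<open>Subgroups acting by left multiplication\<close>

text \<open>\<open>B\<close> is a disjoint union of right cosets of \<open>S\<close>, namely those
  of its own elements.\<close>

lemma (in group) card_subgroup_dvd_left_invariant:
  assumes S: "subgroup S G" and B: "B \<subseteq> carrier G" "finite B"
    and closed: "\<And>s b. s \<in> S \<Longrightarrow> b \<in> B \<Longrightarrow> s \<otimes> b \<in> B"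
  shows "card S dvd card B"
proof -
  have cosets: "(\<lambda>b. S #> b) ` B \<subseteq> rcosets S"
    using B(1) by (auto simp: RCOSETS_def)
  have "\<Union>((\<lambda>b. S #> b) ` B) = B"
  proof
    show "\<Union>((\<lambda>b. S #> b) ` B) \<subseteq> B"
      using closed by (auto simp: r_coset_def)
    show "B \<subseteq> \<Union>((\<lambda>b. S #> b) ` B)"
      using rcos_self[OF _ S] B(1) by blast
  qed
  moreover have "card S dvd card (\<Union>((\<lambda>b. S #> b) ` B))"
  proof (rule dvd_partition)
    show "finite (\<Union>((\<lambda>b. S #> b) ` B))"
      using B(2) calculation by simp
    show "\<forall>c\<in>(\<lambda>b. S #> b) ` B. card S dvd card c"
      using cosets card_rcosets_equal[OF _ subgroup.subset[OF S]] by fastforce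
    show "\<forall>c1\<in>(\<lambda>b. S #> b) ` B. \<forall>c2\<in>(\<lambda>b. S #> b) ` B. c1 \<noteq> c2 \<longrightarrow> c1 \<inter> c2 = {}"
      using cosets rcos_disjoint[OF S] unfolding pairwise_def disjnt_def by blast
  qed
  ultimately show ?thesis by simp
qed

text \<open>Only \<open>h B\<close> inside \<open>B\<close> is asked. For a finite \<open>B\<close>
  in the carrier this already means equality, because left multiplication is injective.\<close>

definition left_stabilizer :: "('a, 'b) monoid_scheme \<Rightarrow> 'a set \<Rightarrow> 'a set"
  where "left_stabilizer G B = {h \<in> carrier G. \<forall>b\<in>B. h \<otimes>\<^bsub>G\<^esub> b \<in> B}"

lemma (in group) subgroup_left_stabilizer:
  assumes B: "B \<subseteq> carrier G" "finite B"
  shows "subgroup (left_stabilizer G B) G"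
proof
  show "left_stabilizer G B \<subseteq> carrier G" "\<one> \<in> left_stabilizer G B"
    using B(1) by (auto simp: left_stabilizer_def subset_iff)
  show "h \<otimes> k \<in> left_stabilizer G B"
    if "h \<in> left_stabilizer G B" "k \<in> left_stabilizer G B" for h k
    using that B(1) by (auto simp: left_stabilizer_def m_assoc subset_iff)
  show "inv h \<in> left_stabilizer G B" if h: "h \<in> left_stabilizer G B" for h
  proof -
    have hG: "h \<in> carrier G" and hB: "\<And>b. b \<in> B \<Longrightarrow> h \<otimes> b \<in> B"
      using h by (auto simp: left_stabilizer_def)
    have "inj_on (\<lambda>b. h \<otimes> b) B"
      using hG B(1) by (intro inj_onI) (simp add: subset_iff)
    then have "(\<lambda>b. h \<otimes> b) ` B = B"
      using hB by (intro endo_inj_surj B(2)) auto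
    then have "inv h \<otimes> b \<in> B" if "b \<in> B" for b
      using that hG B(1) by (smt (verit) image_iff inv_solve_left subset_iff)
    then show ?thesis using hG by (simp add: left_stabilizer_def)
  qed
qed

section \<open>Orbits of points and of pairs\<close>

lemma (in group_action) orbit_eqI:
  assumes "x \<in> E" "y \<in> orbit G \<phi> x"
  shows "orbit G \<phi> y = orbit G \<phi> x"
proof -
  have yE: "y \<in> E" using assms element_image by (auto simp: orbit_def)
  have sub: "orbit G \<phi> z \<subseteq> E" if "z \<in> E" for z
    using that element_image by (auto simp: orbit_def)
  show ?thesis
    using orbit_trans orbit_sym assms yE sub by (meson subsetD subsetI subset_antisym)
qed

text \<open>The diagonal action, so that the orbit-stabiliser theorem applies to pairs. It is
  restricted to \<open>E \<times> E\<close> because \<open>Bij\<close> contains only extensional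
  functions.\<close>

lemma (in group_action) group_action_pair:
  "group_action G (E \<times> E) (\<lambda>g. \<lambda>p \<in> E \<times> E. (\<phi> g (fst p), \<phi> g (snd p)))"
proof -
  interpret G: group G using group_hom group_hom.axioms(1) by blast
  let ?\<psi> = "\<lambda>g. \<lambda>p \<in> E \<times> E. (\<phi> g (fst p), \<phi> g (snd p))"
  have bij: "?\<psi> g \<in> Bij (E \<times> E)" if g: "g \<in> carrier G" for g
  proof -
    have "bij_betw (map_prod (\<phi> g) (\<phi> g)) (E \<times> E) (E \<times> E)"
      using bij_prop0[OF g] by (intro bij_betw_map_prod) (auto simp: Bij_def)
    moreover have "bij_betw (?\<psi> g) (E \<times> E) (E \<times> E) =
        bij_betw (map_prod (\<phi> g) (\<phi> g)) (E \<times> E) (E \<times> E)"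
      by (rule bij_betw_cong) auto
    ultimately show ?thesis by (auto simp: Bij_def)
  qed
  have "?\<psi> (g \<otimes> h) = compose (E \<times> E) (?\<psi> g) (?\<psi> h)"
    if "g \<in> carrier G" "h \<in> carrier G" for g h
  proof
    fix p
    show "?\<psi> (g \<otimes> h) p = compose (E \<times> E) (?\<psi> g) (?\<psi> h) p"
      using composition_rule[OF _ that] element_image[OF that(2) _ refl]
      by (cases "p \<in> E \<times> E") (auto simp: compose_def mem_Times_iff)
  qed
  then have "?\<psi> \<in> hom G (BijGroup (E \<times> E))"
    unfolding hom_def BijGroup_def using bij by simp
  then show ?thesis
    by (simp add: group_action_def group_hom_def group_hom_axioms_def group_BijGroup G.group_axioms)
qed

text \<open>The stabiliser of \<open>(x, y)\<close> is the intersection of the two stabilisers, so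
  the size of its orbit is divisible by both orbit sizes, hence by their product. That orbit lies in
  the product of the two orbits and thus fills it.\<close>

lemma (in group_action) coprime_orbits_pair:
  assumes "finite (carrier G)" "x \<in> E" "y \<in> E"
    and "coprime (card (orbit G \<phi> x)) (card (orbit G \<phi> y))"
  shows "order G = card (orbit G \<phi> x) * card (orbit G \<phi> y) *
      card (stabilizer G \<phi> x \<inter> stabilizer G \<phi> y)"
    and "x' \<in> orbit G \<phi> x \<Longrightarrow> y' \<in> orbit G \<phi> y \<Longrightarrow>
      \<exists>g\<in>carrier G. \<phi> g x = x' \<and> \<phi> g y = y'"
proof -
  interpret G: group G using group_hom group_hom.axioms(1) by blast
  let ?\<psi> = "\<lambda>g. \<lambda>p \<in> E \<times> E. (\<phi> g (fst p), \<phi> g (snd p))"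
  interpret P: group_action G "E \<times> E" ?\<psi> by (rule group_action_pair)
  let ?X = "orbit G \<phi> x" and ?Y = "orbit G \<phi> y" and ?O = "orbit G ?\<psi> (x, y)"
  let ?S = "stabilizer G \<phi> x \<inter> stabilizer G \<phi> y"
  have stab: "stabilizer G ?\<psi> (x, y) = ?S"
    using assms by (auto simp: stabilizer_def)
  have orderO: "card ?O * card ?S = order G"
    using P.orbit_stabilizer_theorem[of "(x, y)"] assms stab by simp
  have "order G > 0"
    using assms(1) G.order_gt_0_iff_finite by simp
  then have S0: "card ?S > 0" and O0: "card ?O > 0"
    unfolding orderO[symmetric] by simp_all
  have fin: "finite ?X" "finite ?Y"
    using assms(1) by (simp_all add: orbit_def)
  have S: "subgroup ?S G"
    by (intro G.subgroups_Inter_pair stabilizer_subgroup assms)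
  \<comment> \<open>The index of \<open>?S\<close> is a multiple of the index of every point
    stabiliser containing it.\<close>
  have dvd: "card (orbit G \<phi> z) dvd card ?O" if "z \<in> E" "?S \<subseteq> stabilizer G \<phi> z" for z
  proof -
    have "card ?S dvd card (stabilizer G \<phi> z)"
    proof (rule G.card_subgroup_dvd_left_invariant[OF S])
      show "finite (stabilizer G \<phi> z)"
        using assms(1) stabilizer_subset finite_subset by blast
    qed (use that stabilizer_subset stabilizer_m_closed in blast)+
    then obtain k where "card (stabilizer G \<phi> z) = card ?S * k" ..
    then have "card (orbit G \<phi> z) * k * card ?S = card ?O * card ?S"
      using orbit_stabilizer_theorem[OF that(1)] orderO by (simp add: mult_ac)
    then have "card ?O = card (orbit G \<phi> z) * k" using S0 by simp
    then show ?thesis by (rule dvdI)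
  qed
  have "card ?X * card ?Y dvd card ?O"
    using dvd[OF assms(2)] dvd[OF assms(3)] assms(4) by (simp add: divides_mult)
  then have "card (?X \<times> ?Y) \<le> card ?O"
    using O0 by (simp add: card_cartesian_product dvd_imp_le)
  moreover have "?O \<subseteq> ?X \<times> ?Y"
    using assms by (auto simp: orbit_def)
  ultimately have O: "?O = ?X \<times> ?Y"
    using fin by (intro card_seteq) auto
  then show "order G = card ?X * card ?Y * card ?S"
    using orderO by (simp add: card_cartesian_product)
  show "\<exists>g\<in>carrier G. \<phi> g x = x' \<and> \<phi> g y = y'" if "x' \<in> ?X" "y' \<in> ?Y"
  proof -
    have "(x', y') \<in> ?O" using O that by simp
    then show ?thesis using assms by (auto simp: orbit_def)
  qed
qed

section \<open>Orbits of products under automorphisms\<close>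

locale automorphism_action = G: group G + H: group H
  for G :: "('g, 'c) monoid_scheme" and H :: "('h, 'd) monoid_scheme" and \<alpha> +
  assumes finite_G: "finite (carrier G)" and finite_H: "finite (carrier H)"
    and hom_Auto: "\<alpha> \<in> hom G (AutoGroup H)"
begin

sublocale group_action G "carrier H" \<alpha>
proof -
  have "\<alpha> \<in> hom G (BijGroup (carrier H))"
    using hom_Auto by (auto simp: hom_def AutoGroup_def auto_def BijGroup_def)
  then show "group_action G (carrier H) \<alpha>"
    by (simp add: group_action_def group_hom_def group_hom_axioms_def group_BijGroup G.group_axioms)
qed

abbreviation orb :: "'h \<Rightarrow> 'h set" where "orb \<equiv> orbit G \<alpha>"

lemma hom_action: "g \<in> carrier G \<Longrightarrow> \<alpha> g \<in> hom H H"
  using hom_Auto by (auto simp: hom_def AutoGroup_def auto_def)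

lemma action_mult:
  "g \<in> carrier G \<Longrightarrow> a \<in> carrier H \<Longrightarrow> b \<in> carrier H \<Longrightarrow>
    \<alpha> g (a \<otimes>\<^bsub>H\<^esub> b) = \<alpha> g a \<otimes>\<^bsub>H\<^esub> \<alpha> g b"
  using hom_action by (simp add: hom_def)

lemma action_inv:
  "g \<in> carrier G \<Longrightarrow> a \<in> carrier H \<Longrightarrow> \<alpha> g (inv\<^bsub>H\<^esub> a) = inv\<^bsub>H\<^esub> (\<alpha> g a)"
  using group_hom.hom_inv[of H H "\<alpha> g" a] hom_action
  by (simp add: group_hom_def group_hom_axioms_def H.group_axioms)

lemma orb_subset: "a \<in> carrier H \<Longrightarrow> orb a \<subseteq> carrier H"
  using element_image by (auto simp: orbit_def)

lemma finite_orb: "finite (orb a)"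
  using finite_G by (simp add: orbit_def)

lemma orb_inv: "a \<in> carrier H \<Longrightarrow> orb (inv\<^bsub>H\<^esub> a) = (\<lambda>x. inv\<^bsub>H\<^esub> x) ` orb a"
  using action_inv by (force simp: orbit_def)

lemma card_orb_inv:
  assumes "a \<in> carrier H" shows "card (orb (inv\<^bsub>H\<^esub> a)) = card (orb a)"
proof -
  have "inj_on (\<lambda>x. inv\<^bsub>H\<^esub> x) (orb a)"
    using inj_on_subset[OF H.inv_inj] assms orb_subset by blast
  then show ?thesis using assms by (simp add: orb_inv card_image)
qed

text \<open>By transitivity on pairs a single \<open>g\<close> takes \<open>(a, b)\<close> to
  \<open>(a', b')\<close>. So the product set of two orbits of coprime sizes lies in one
  orbit.\<close>

lemma mult_mem_orb_mult:
  assumes "a \<in> carrier H" "b \<in> carrier H" "coprime (card (orb a)) (card (orb b))"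
    and "a' \<in> orb a" "b' \<in> orb b"
  shows "a' \<otimes>\<^bsub>H\<^esub> b' \<in> orb (a \<otimes>\<^bsub>H\<^esub> b)"
proof -
  obtain g where g: "g \<in> carrier G" "\<alpha> g a = a'" "\<alpha> g b = b'"
    using coprime_orbits_pair(2)[OF finite_G assms] by blast
  then have "a' \<otimes>\<^bsub>H\<^esub> b' = \<alpha> g (a \<otimes>\<^bsub>H\<^esub> b)"
    using action_mult assms by simp
  then show ?thesis
    using g(1) by (auto simp: orbit_def)
qed

text \<open>The common stabiliser of \<open>a\<close> and \<open>b\<close> fixes their product, and
  by coprimality its index is the product of the orbit sizes. The index of the larger stabiliser
  divides it.\<close>

lemma card_orb_mult_dvd:
  assumes "a \<in> carrier H" "b \<in> carrier H" "coprime (card (orb a)) (card (orb b))"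
  shows "card (orb (a \<otimes>\<^bsub>H\<^esub> b)) dvd card (orb a) * card (orb b)"
proof -
  let ?S = "stabilizer G \<alpha> a \<inter> stabilizer G \<alpha> b" and ?T = "stabilizer G \<alpha> (a \<otimes>\<^bsub>H\<^esub> b)"
  have "card ?S dvd card ?T"
  proof (rule G.card_subgroup_dvd_left_invariant)
    show "subgroup ?S G"
      by (intro G.subgroups_Inter_pair stabilizer_subgroup assms)
    show "?T \<subseteq> carrier G" "finite ?T"
      using finite_G stabilizer_subset finite_subset by blast+
    have "?S \<subseteq> ?T"
      using assms by (auto simp: stabilizer_def action_mult)
    then show "s \<otimes>\<^bsub>G\<^esub> t \<in> ?T" if "s \<in> ?S" "t \<in> ?T" for s t
      using that stabilizer_m_closed[of "a \<otimes>\<^bsub>H\<^esub> b"] assms by blast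
  qed
  then obtain k where k: "card ?T = card ?S * k" ..
  have eq: "card (orb a) * card (orb b) * card ?S = order G"
    using coprime_orbits_pair(1)[OF finite_G assms] by simp
  also have "\<dots> = card (orb (a \<otimes>\<^bsub>H\<^esub> b)) * k * card ?S"
    using orbit_stabilizer_theorem[of "a \<otimes>\<^bsub>H\<^esub> b"] k assms by (simp add: mult_ac)
  finally have "card (orb a) * card (orb b) * card ?S = card (orb (a \<otimes>\<^bsub>H\<^esub> b)) * k * card ?S" .
  moreover have "order G > 0" using finite_G G.order_gt_0_iff_finite by simp
  then have "card ?S \<noteq> 0" unfolding eq[symmetric] by simp
  ultimately have "card (orb a) * card (orb b) = card (orb (a \<otimes>\<^bsub>H\<^esub> b)) * k" by simp
  then show ?thesis by (rule dvdI)
qed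

text \<open>Left translation by \<open>a\<close> embeds \<open>orb b\<close> in the orbit of the
  product.\<close>

lemma card_orb_le_card_orb_mult:
  assumes "a \<in> carrier H" "b \<in> carrier H" "coprime (card (orb a)) (card (orb b))"
  shows "card (orb b) \<le> card (orb (a \<otimes>\<^bsub>H\<^esub> b))"
proof (rule card_inj_on_le)
  show "inj_on (\<lambda>x. a \<otimes>\<^bsub>H\<^esub> x) (orb b)"
    using assms orb_subset[OF assms(2)] by (intro inj_onI) (simp add: subset_iff)
  show "(\<lambda>x. a \<otimes>\<^bsub>H\<^esub> x) ` orb b \<subseteq> orb (a \<otimes>\<^bsub>H\<^esub> b)"
    using mult_mem_orb_mult[OF assms] orbit_refl assms(1) by blast
qed (rule finite_orb)

section \<open>Far orbits and left stabilisers\<close>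

text \<open>For non-trivial orbits this is distance at least 3 in the graph, put as arithmetic.
  \<open>c\<close> may range over the whole carrier, since an orbit of size 1 is coprime to all
  others.\<close>

definition far :: "'h \<Rightarrow> 'h \<Rightarrow> bool"
  where "far a b \<longleftrightarrow> coprime (card (orb a)) (card (orb b)) \<and>
    (\<forall>c\<in>carrier H. coprime (card (orb a)) (card (orb c)) \<or> coprime (card (orb b)) (card (orb c)))"

lemma far_sym: "far a b \<Longrightarrow> far b a"
  by (auto simp: far_def coprime_commute)

text \<open>The set product \<open>orb a \<cdot> orb b\<close> is one orbit, of the same size as \<open>orb b\<close>; multiplying it by
  \<open>(orb a)\<inverse>\<close> gives again one orbit, which contains \<open>b\<close> and hence is \<open>orb b\<close>.\<close>

lemma far_imp_left_stabilizer_inv: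
  assumes a: "a \<in> carrier H" and b: "b \<in> carrier H" and far: "far a b"
    and less: "card (orb a) < card (orb b)"
    and a': "a' \<in> orb a" and a'': "a'' \<in> orb a"
  shows "inv\<^bsub>H\<^esub> a' \<otimes>\<^bsub>H\<^esub> a'' \<in> left_stabilizer H (orb b)"
proof -
  \<comment> \<open>Formed with \<open>a'\<close> instead of \<open>a\<close>, so that multiplying
    by the inverse of \<open>a'\<close> gives back exactly \<open>b\<close>.\<close>
  let ?c = "a' \<otimes>\<^bsub>H\<^esub> b"
  have cop: "coprime (card (orb a)) (card (orb b))" using far by (simp add: far_def)
  have a'H: "a' \<in> carrier H" and a''H: "a'' \<in> carrier H"
    using a a' a'' orb_subset by blast+
  have orb_a': "orb a' = orb a" using orbit_eqI a a' by blast
  have dvd: "card (orb ?c) dvd card (orb a) * card (orb b)"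
    and le: "card (orb b) \<le> card (orb ?c)"
    using card_orb_mult_dvd[OF a'H b] card_orb_le_card_orb_mult[OF a'H b] cop by (simp_all add: orb_a')
  \<comment> \<open>Otherwise \<open>orb ?c\<close> is coprime to \<open>orb b\<close>, so its size
    divides that of \<open>orb a\<close>. This makes it smaller than \<open>orb b\<close>, which
    embeds in it.\<close>
  have cop_ac: "coprime (card (orb a)) (card (orb ?c))"
  proof (rule ccontr)
    assume "\<not> ?thesis"
    then have "coprime (card (orb b)) (card (orb ?c))"
      using far a'H b by (auto simp: far_def)
    then have "card (orb ?c) dvd card (orb a)"
      using dvd by (simp add: coprime_dvd_mult_left_iff coprime_commute)
    moreover have "card (orb a) > 0"
      using finite_orb[of a] orbit_refl[OF a] by (auto simp: card_gt_0_iff)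
    ultimately have "card (orb ?c) \<le> card (orb a)" by (rule dvd_imp_le)
    then show False using le less by simp
  qed
  have "inv\<^bsub>H\<^esub> a' \<otimes>\<^bsub>H\<^esub> a'' \<otimes>\<^bsub>H\<^esub> b' \<in> orb b" if b': "b' \<in> orb b" for b'
  proof -
    have b'H: "b' \<in> carrier H" using b b' orb_subset by blast
    have "a'' \<otimes>\<^bsub>H\<^esub> b' \<in> orb ?c"
      using mult_mem_orb_mult[OF a'H b] cop a'' b' by (simp add: orb_a')
    \<comment> \<open>Coprimality of \<open>orb a\<close> and \<open>orb ?c\<close> allows a second
      product, now of the orbits of the inverse of \<open>a'\<close> and of
      \<open>?c\<close>.\<close>
    then have "inv\<^bsub>H\<^esub> a' \<otimes>\<^bsub>H\<^esub> (a'' \<otimes>\<^bsub>H\<^esub> b') \<in> orb (inv\<^bsub>H\<^esub> a' \<otimes>\<^bsub>H\<^esub> ?c)"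
      using mult_mem_orb_mult[of "inv\<^bsub>H\<^esub> a'" ?c] cop_ac a'H b orbit_refl
      by (simp add: card_orb_inv orb_a')
    then show ?thesis
      using a'H a''H b b'H by (simp flip: H.m_assoc)
  qed
  then show ?thesis using a'H a''H by (simp add: left_stabilizer_def)
qed

text \<open>The inverse of \<open>a\<close> is far from \<open>b\<close> as well, and its orbit
  consists of the inverses of \<open>orb a\<close>.\<close>

lemma far_imp_left_stabilizer:
  assumes a: "a \<in> carrier H" and b: "b \<in> carrier H" and far: "far a b"
    and less: "card (orb a) < card (orb b)"
    and a': "a' \<in> orb a" and a'': "a'' \<in> orb a"
  shows "a' \<otimes>\<^bsub>H\<^esub> inv\<^bsub>H\<^esub> a'' \<in> left_stabilizer H (orb b)"
proof -
  have "a' \<in> carrier H" using a a' orb_subset by blast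
  moreover have "far (inv\<^bsub>H\<^esub> a) b"
    using far a by (simp add: far_def card_orb_inv)
  ultimately show ?thesis
    using far_imp_left_stabilizer_inv[of "inv\<^bsub>H\<^esub> a" b "inv\<^bsub>H\<^esub> a'" "inv\<^bsub>H\<^esub> a''"] assms
      card_orb_inv[OF a]
    by (simp add: orb_inv)
qed

text \<open>\<open>card S\<close> divides two coprime numbers, so \<open>S\<close> is trivial and
  any two elements of \<open>orb x\<close> coincide.\<close>

lemma trivial_orb_of_left_stabilizers:
  assumes x: "x \<in> carrier H" and S: "subgroup S H"
    and xS: "\<And>x' x''. x' \<in> orb x \<Longrightarrow> x'' \<in> orb x \<Longrightarrow> x' \<otimes>\<^bsub>H\<^esub> inv\<^bsub>H\<^esub> x'' \<in> S"
    and y: "y \<in> carrier H" and z: "z \<in> carrier H"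
    and Sy: "S \<subseteq> left_stabilizer H (orb y)" and Sz: "S \<subseteq> left_stabilizer H (orb z)"
    and cop: "coprime (card (orb y)) (card (orb z))"
  shows "card (orb x) \<le> 1"
proof -
  have "card S dvd card (orb y)" "card S dvd card (orb z)"
    using Sy Sz orb_subset[OF y] orb_subset[OF z]
    by (auto intro!: H.card_subgroup_dvd_left_invariant[OF S]
        simp: finite_orb left_stabilizer_def)
  then have "card S = 1"
    using cop coprime_common_divisor_nat by blast
  then have "S = {\<one>\<^bsub>H\<^esub>}"
    using subgroup.one_closed[OF S] by (metis card_1_singletonE singletonD)
  then have "x' = x''" if "x' \<in> orb x" "x'' \<in> orb x" for x' x''
    using xS[OF that] that orb_subset[OF x] H.inv_solve_right'[of "\<one>\<^bsub>H\<^esub>" x' x'']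
    by (auto simp: subset_iff)
  then show ?thesis
    using finite_orb[of x] by (simp add: card_le_Suc0_iff_eq)
qed

text \<open>The contradiction to which a long geodesic from \<open>orb x\<close> to
  \<open>orb z\<close> leads. Either of \<open>orb x\<close> and \<open>orb y\<close> may be the
  smaller one, and each case has its own subgroup.\<close>

lemma not_far_far_coprime:
  assumes x: "x \<in> carrier H" and y: "y \<in> carrier H" and z: "z \<in> carrier H"
    and x1: "card (orb x) > 1" and y1: "card (orb y) > 1"
    and xy: "far x y" and xz: "far x z" and cop: "coprime (card (orb y)) (card (orb z))"
    and less: "card (orb x) < card (orb z)"
  shows False
proof -
  have "card (orb x) \<noteq> card (orb y)"
    using xy x1 by (auto simp: far_def)
  then consider "card (orb x) < card (orb y)" | "card (orb y) < card (orb x)" by linarith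
  then show False
  proof cases
    case 1
    \<comment> \<open>Stands in for the subgroup generated by the quotients from
      \<open>orb x\<close>: it contains them, and its order divides both orbit sizes.\<close>
    let ?S = "left_stabilizer H (orb y) \<inter> left_stabilizer H (orb z)"
    have "card (orb x) \<le> 1"
    proof (rule trivial_orb_of_left_stabilizers[OF x _ _ y z _ _ cop, of ?S])
      show "subgroup ?S H"
        by (intro H.subgroups_Inter_pair H.subgroup_left_stabilizer orb_subset finite_orb y z)
      show "x' \<otimes>\<^bsub>H\<^esub> inv\<^bsub>H\<^esub> x'' \<in> ?S" if "x' \<in> orb x" "x'' \<in> orb x" for x' x''
        using that far_imp_left_stabilizer x y z xy xz 1 less by simp
    qed simp_all
    then show False using x1 by simp
  next
    case 2
    let ?S = "left_stabilizer H (orb x)"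
    \<comment> \<open>Each \<open>s\<close> is the quotient of \<open>s x\<close> by
      \<open>x\<close>, two elements of \<open>orb x\<close>.\<close>
    have sub: "?S \<subseteq> left_stabilizer H (orb z)"
    proof
      fix s assume s: "s \<in> ?S"
      then have "s \<otimes>\<^bsub>H\<^esub> x \<in> orb x" and sH: "s \<in> carrier H"
        using orbit_refl[OF x] by (auto simp: left_stabilizer_def)
      then have "s \<otimes>\<^bsub>H\<^esub> x \<otimes>\<^bsub>H\<^esub> inv\<^bsub>H\<^esub> x \<in> left_stabilizer H (orb z)"
        using far_imp_left_stabilizer[OF x z xz less] orbit_refl[OF x] by blast
      then show "s \<in> left_stabilizer H (orb z)"
        using sH x by (simp add: H.m_assoc)
    qed
    \<comment> \<open>The roles change: now the quotients come from \<open>orb y\<close>, and the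
      coprime pair is \<open>orb x\<close>, \<open>orb z\<close>.\<close>
    have "card (orb y) \<le> 1"
    proof (rule trivial_orb_of_left_stabilizers[OF y _ _ x z _ sub])
      show "subgroup ?S H"
        by (intro H.subgroup_left_stabilizer orb_subset finite_orb x)
      show "coprime (card (orb x)) (card (orb z))" using xz by (simp add: far_def)
      show "x' \<otimes>\<^bsub>H\<^esub> inv\<^bsub>H\<^esub> x'' \<in> ?S" if "x' \<in> orb y" "x'' \<in> orb y" for x' x''
        using that far_imp_left_stabilizer[OF y x far_sym[OF xy] 2] by simp
    qed simp
    then show False using y1 by simp
  qed
qed

section \<open>Distances in the orbit graph\<close>

abbreviation adj :: "'h set \<Rightarrow> 'h set \<Rightarrow> bool" where "adj \<equiv> orbit_graph_adj G H \<alpha>"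
abbreviation V :: "'h set set" where "V \<equiv> orbit_graph_vertices G H \<alpha>"

lemma adj_sym: "adj A B \<Longrightarrow> adj B A"
  by (auto simp: orbit_graph_adj_def gcd.commute)

lemma adj_vertices: "adj A B \<Longrightarrow> A \<in> V \<and> B \<in> V"
  by (auto simp: orbit_graph_adj_def)

lemma relpowp_adj_sym: "(adj ^^ n) A B \<Longrightarrow> (adj ^^ n) B A"
proof (induction n arbitrary: B)
  case (Suc n)
  from Suc.prems obtain C where "(adj ^^ n) A C" "adj C B" by (rule relpowp_Suc_E)
  then show ?case using Suc.IH adj_sym relpowp_Suc_I2 by metis
qed auto

lemma vertexE:
  assumes "A \<in> V"
  obtains a where "a \<in> carrier H" "A = orb a" "card (orb a) > 1"
  using assms by (auto simp: orbit_graph_vertices_def orbits_def)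

lemma orb_in_V: "a \<in> carrier H \<Longrightarrow> card (orb a) > 1 \<Longrightarrow> orb a \<in> V"
  by (auto simp: orbit_graph_vertices_def orbits_def)

text \<open>Distances are bounded below by excluding relation powers; exponents 0 and 1 are equality
  and adjacency.\<close>

lemma coprime_of_dist:
  assumes "A \<in> V" "B \<in> V" "\<And>k. k < 2 \<Longrightarrow> \<not> (adj ^^ k) A B"
  shows "coprime (card A) (card B)"
proof -
  have "A \<noteq> B" "\<not> adj A B" using assms(3)[of 0] assms(3)[of 1] by auto
  then show ?thesis using assms(1,2) by (simp add: orbit_graph_adj_def coprime_iff_gcd_eq_1)
qed

text \<open>An orbit sharing a factor with both would be non-trivial and, as the two are coprime,
  different from each: the middle of a path of length 2.\<close>

lemma far_of_dist:
  assumes a: "a \<in> carrier H" "card (orb a) > 1" and b: "b \<in> carrier H" "card (orb b) > 1"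
    and dist: "\<And>k. k < 3 \<Longrightarrow> \<not> (adj ^^ k) (orb a) (orb b)"
  shows "far a b"
proof -
  have cop: "coprime (card (orb a)) (card (orb b))"
    using a b dist by (intro coprime_of_dist orb_in_V) auto
  have "coprime (card (orb a)) (card (orb c)) \<or> coprime (card (orb b)) (card (orb c))"
    if c: "c \<in> carrier H" for c
  proof (rule ccontr)
    assume neg: "\<not> ?thesis"
    have "card (orb c) \<noteq> 0"
      using finite_orb orbit_refl[OF c] by auto
    moreover have "card (orb c) \<noteq> 1" using neg by auto
    ultimately have "orb c \<in> V" using c by (intro orb_in_V) auto
    moreover have "orb c \<noteq> orb a" "orb c \<noteq> orb b"
      using neg cop by (auto simp: coprime_commute)
    ultimately have "adj (orb a) (orb c)" "adj (orb c) (orb b)"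
      using neg a b orb_in_V by (auto simp: orbit_graph_adj_def coprime_iff_gcd_eq_1 gcd.commute)
    then have "(adj ^^ 2) (orb a) (orb b)" by (auto simp: numeral_2_eq_2)
    then show False using dist[of 2] by simp
  qed
  then show ?thesis using cop by (simp add: far_def)
qed

text \<open>The bound splits as 5 = 3 + 2: on a geodesic, the vertex two steps before
  \<open>B\<close> is at distance at least 3 from \<open>A\<close> and is not adjacent to
  \<open>B\<close>.\<close>

lemma no_dist_ge_5_less:
  assumes A: "A \<in> V" and B: "B \<in> V" and less: "card A < card B"
    and path: "(adj ^^ n) A B" and n: "n \<ge> 5" and min: "\<And>k. k < n \<Longrightarrow> \<not> (adj ^^ k) A B"
  shows False
proof -
  have "n - 2 + 2 = n" using n by simp
  then have "(adj ^^ (n - 2 + 2)) A B" using path by metis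
  then obtain Y where AY: "(adj ^^ (n - 2)) A Y" and YB: "(adj ^^ 2) Y B"
    unfolding relpowp_add by blast
  have Y: "Y \<in> V"
    using YB adj_vertices by (auto simp: numeral_2_eq_2)
  have AY_min: "\<not> (adj ^^ k) A Y" if "k < 3" for k
  proof
    assume "(adj ^^ k) A Y"
    then have "(adj ^^ (k + 2)) A B" using YB unfolding relpowp_add by blast
    then show False using min[of "k + 2"] that n by simp
  qed
  have YB_min: "\<not> (adj ^^ k) Y B" if "k < 2" for k
  proof
    assume "(adj ^^ k) Y B"
    then have "(adj ^^ (n - 2 + k)) A B" using AY unfolding relpowp_add by blast
    moreover have "n - 2 + k < n" using that n by linarith
    ultimately show False using min by blast
  qed
  obtain x where x: "x \<in> carrier H" "A = orb x" "card (orb x) > 1" using A by (rule vertexE)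
  obtain y where y: "y \<in> carrier H" "Y = orb y" "card (orb y) > 1" using Y by (rule vertexE)
  obtain z where z: "z \<in> carrier H" "B = orb z" "card (orb z) > 1" using B by (rule vertexE)
  have "far x y"
    using far_of_dist[OF x(1,3) y(1,3)] AY_min unfolding x(2) y(2) .
  moreover have "far x z"
    using far_of_dist[OF x(1,3) z(1,3)] min n unfolding x(2) z(2) by simp
  moreover have "coprime (card (orb y)) (card (orb z))"
    using coprime_of_dist[OF Y B YB_min] y z by simp
  ultimately show False
    using not_far_far_coprime[OF x(1) y(1) z(1) x(3) y(3)] less x z by simp
qed

text \<open>At distance 5 or more the two sizes are coprime, hence different, and by symmetry the
  path may start at the smaller orbit.\<close>

lemma dist_le_4:
  assumes A: "A \<in> V" and B: "B \<in> V" and path: "(adj ^^ n) A B"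
  obtains k where "k \<le> 4" "(adj ^^ k) A B"
proof -
  define m where "m = (LEAST k. (adj ^^ k) A B)"
  have m: "(adj ^^ m) A B" unfolding m_def using path by (rule LeastI)
  have min: "\<not> (adj ^^ k) A B" if "k < m" for k
    using that not_less_Least unfolding m_def by blast
  have "m \<le> 4"
  proof (rule ccontr)
    assume "\<not> m \<le> 4"
    then have m5: "m \<ge> 5" by simp
    have "coprime (card A) (card B)"
      using coprime_of_dist[OF A B] min m5 by simp
    moreover have "card A > 1" using A by (simp add: orbit_graph_vertices_def)
    ultimately have "card A \<noteq> card B" by auto
    then consider "card A < card B" | "card B < card A" by linarith
    then show False
    proof cases
      case 1
      then show False using no_dist_ge_5_less[OF A B _ m m5] min by blast
    next
      case 2
      then show False
        using no_dist_ge_5_less[OF B A _ relpowp_adj_sym[OF m] m5] min relpowp_adj_sym by blast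
    qed
  qed
  then show ?thesis using m that by blast
qed

section \<open>Walks and relation powers\<close>

lemma relpowp_of_walk:
  assumes "orbit_graph_walk G H \<alpha> ps"
  shows "(adj ^^ (length ps - 1)) (hd ps) (last ps)"
  unfolding relpowp_fun_conv
proof (intro exI conjI allI impI)
  show "ps ! 0 = hd ps" "ps ! (length ps - 1) = last ps"
    using assms by (simp_all add: orbit_graph_walk_def hd_conv_nth last_conv_nth)
  show "adj (ps ! i) (ps ! Suc i)" if "i < length ps - 1" for i
    using assms that by (simp add: orbit_graph_walk_def)
qed

lemma walk_of_relpowp:
  assumes A: "A \<in> V" and "(adj ^^ n) A B"
  obtains ps where "orbit_graph_walk G H \<alpha> ps" "hd ps = A" "last ps = B" "length ps = Suc n"
proof -
  obtain f where f: "f 0 = A" "f n = B" "\<And>i. i < n \<Longrightarrow> adj (f i) (f (Suc i))"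
    using assms(2) unfolding relpowp_fun_conv by blast
  \<comment> \<open>For \<open>i = 0\<close> the assumption on \<open>A\<close> is used, as there
    may be no edge at all; every later vertex ends an edge.\<close>
  have "f i \<in> V" if "i \<le> n" for i
    using that A f(1) adj_vertices[OF f(3)] by (cases i) auto
  moreover have "map f [0..<Suc n] ! i = f i" if "i \<le> n" for i
    using that nth_map_upt[of i "Suc n" 0 f] by simp
  ultimately have "orbit_graph_walk G H \<alpha> (map f [0..<Suc n])"
    using f(3) by (auto simp: orbit_graph_walk_def simp del: upt_Suc)
  moreover have "hd (map f [0..<Suc n]) = A" "last (map f [0..<Suc n]) = B"
    using f by (simp_all add: hd_map del: upt_Suc) simp
  ultimately show ?thesis using that[of "map f [0..<Suc n]"] by simp
qed

end

theorem mainTheorem3: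
  fixes G :: "('g, 'c) monoid_scheme" and H :: "('h, 'd) monoid_scheme"
    and \<alpha> :: "'g \<Rightarrow> 'h \<Rightarrow> 'h"
  assumes "group G" and "group H"
    and "finite (carrier G)" and "finite (carrier H)"
    and "{p::nat. prime p \<and> p dvd order G} = {p. prime p \<and> p dvd order H}"
    and "\<alpha> \<in> hom G (AutoGroup H)"
    and "L1 \<in> orbit_graph_vertices G H \<alpha>" and "L2 \<in> orbit_graph_vertices G H \<alpha>"
    and "\<exists>ps. orbit_graph_walk G H \<alpha> ps \<and> hd ps = L1 \<and> last ps = L2"
  shows "\<exists>ps. orbit_graph_walk G H \<alpha> ps \<and> hd ps = L1 \<and> last ps = L2 \<and> length ps \<le> 5"
proof -
  interpret automorphism_action G H \<alpha>
    using assms by (simp add: automorphism_action_def automorphism_action_axioms_def)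
  obtain n where "(adj ^^ n) L1 L2"
    using assms(9) relpowp_of_walk by blast
  then obtain k where "k \<le> 4" "(adj ^^ k) L1 L2"
    using dist_le_4 assms(7,8) by blast
  moreover from this obtain ps where
    "orbit_graph_walk G H \<alpha> ps" "hd ps = L1" "last ps = L2" "length ps = Suc k"
    using walk_of_relpowp assms(7) by blast
  \<comment> \<open>\<open>k\<close> edges make \<open>Suc k\<close> vertices, so 4 edges correspond
    to list length 5.\<close>
  ultimately show ?thesis by (intro exI[of _ ps]) simp
qed

end
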